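(* Let $\mathcal{H}$ be a real Hilbert space, let $T\colon\mathcal{H}\to\mathcal{H}$ be nonexpansive with infimal displacement vector $v$, let $\lambda_k\in[0,1)$ for $k=1,2,\dots$, and let $\{x^k\}_{k\in\mathbb{N}}$ be the iterates of the Krasnosel'skii--Mann iteration \[ x^{k+1}=\lambda_{k+1}x^k+(1-\lambda_{k+1})Tx^k,\qquad k=0,1,\dots, \] starting from $x^0\in\mathcal{H}$. For any $\varepsilon>0$ and any $x_\varepsilon\in\mathcal{H}$ such that $\|x_\varepsilon-Tx_\varepsilon-v\|\le\min\left\{\frac{\varepsilon^2}{2\|v\|+1},\,1,\,\varepsilon\right\}$, \[ \left\|\frac{x^k-x^0}{\sum_{i=1}^k(1-\lambda_i)}+v\right\|^2\le\left(\frac{2}{\sum_{i=1}^k(1-\lambda_i)}\|x^0-x_\varepsilon\|+\varepsilon\right)^2\qquad\text{for all }k=1,2,\dots. \] If furthermore $v\in\mathcal{R}(I-T)$, then there exists $x_\star\in\mathcal{H}$ such that $x_\star-Tx_\star=v$ and \[ \left\|\frac{x^k-x^0}{\sum_{i=1}^k(1-\lambda_i)}+v\right\|^2\le\frac{4}{\left(\sum_{i=1}^k(1-\lambda_i)\right)^2}\|x^0-x_\star\|^2\qquad\text{for all }k=1,2,\dots. \]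
   Context: $T\colon\mathcal{H}\to\mathcal{H}$ is nonexpansive if $\|Tx-Ty\|\le\|x-y\|$ for all $x,y\in\mathcal{H}$. $I$ is the identity operator and $\mathcal{R}(I-T)=\{x-Tx: x\in\mathcal{H}\}$. For nonexpansive $T$ the closure $\overline{\mathcal{R}(I-T)}$ is nonempty, closed and convex, and the infimal displacement vector of $T$ is its unique minimum-norm element $v=\Pi_{\overline{\mathcal{R}(I-T)}}(0)$ (the projection of $0$ onto it). *)

theory Defs
  imports "HOL-Analysis.Analysis"
begin

text \<open>The projection onto a closed convex subset of a Hilbert space. The library's
  \<^const>\<open>closest_point\<close> requires class \<^class>\<open>heine_borel\<close>, which would restrict the space to
  finite dimension. The description is meaningful only where the nearest point exists and
  is unique.\<close>

definition hilbert_projection :: "'a::real_inner set \<Rightarrow> 'a \<Rightarrow> 'a" where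
  "hilbert_projection S a = (THE p. p \<in> S \<and> (\<forall>y\<in>S. dist a p \<le> dist a y))"

definition infimal_displacement_vector :: "('a::real_inner \<Rightarrow> 'a) \<Rightarrow> 'a" where
  "infimal_displacement_vector T = hilbert_projection (closure (range (\<lambda>x. x - T x))) 0"

end

theory Submission
  imports Defs
begin

text \<open>
  The displacement operator \<open>I - T\<close> is monotone, and the vector \<open>v\<close> of least norm in the closure of
  its range satisfies \<open>\<langle>z - T z, v\<rangle> \<ge> \<parallel>v\<parallel>\<^sup>2\<close> for every \<open>z\<close>.

  The rate rests on this inequality. Write \<open>S\<^sub>k\<close> for the sum
  of the first \<open>k\<close> weights \<open>1 - \<lambda>\<^sub>i\<close>. If \<open>w - T w = v\<close>, the points \<open>w - s v\<close> with \<open>s \<ge> 0\<close> form a ray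
  along which \<open>T\<close> acts as the translation by \<open>-v\<close>; the iteration started at \<open>w\<close> runs along it as
  \<open>w - S\<^sub>k v\<close>, and nonexpansiveness keeps \<open>x\<^sup>k\<close> within \<open>\<parallel>x\<^sup>0 - w\<parallel>\<close> of that comparison point. If
  \<open>w - T w\<close> only approximates \<open>v\<close>, the same comparison point is kept, and one application of \<open>T\<close>
  raises the bound \<open>\<parallel>x\<^sup>0 - w\<parallel> + \<epsilon> s\<close> on the distance by \<open>\<epsilon>\<close> (\<open>distance_to_ray_step\<close>). The reason is that expanding squares
  around the point \<open>w - s v\<close> produces the error term \<open>2 s \<langle>w - T w - v, v\<rangle>\<close>, which grows linearly
  in \<open>s\<close>, and raising the bound by \<open>\<epsilon>\<close> enlarges its square by an amount that grows linearly as well.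
  Averaging these steps gives \<open>\<parallel>x\<^sup>k - w + S\<^sub>k v\<parallel> \<le> \<parallel>x\<^sup>0 - w\<parallel> + \<epsilon> S\<^sub>k\<close>, and the triangle inequality
  followed by division by \<open>S\<^sub>k\<close> yields both rates, the exact one being the case \<open>\<epsilon> = 0\<close>.

  The existence of \<open>v\<close> and its inequality come from the solutions \<open>x\<^sub>\<alpha>\<close> of
  \<open>x = -\<alpha> (x - T x)\<close>: as \<open>\<alpha>\<close> grows, the displacements \<open>x\<^sub>\<alpha> - T x\<^sub>\<alpha>\<close> form a Cauchy sequence, and
  monotonicity passes to its limit (\<open>displacement_variational_vector_exists\<close>). A point of the closure
  of the range that satisfies the inequality is its unique point of least norm
  (\<open>hilbert_projection_zero_eqI\<close>), hence this limit is \<open>v\<close>.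
\<close>

section \<open>The infimal displacement vector\<close>

lemma displacement_monotone:
  fixes T :: "'h::real_inner \<Rightarrow> 'h"
  assumes "1-lipschitz_on UNIV T"
  shows "0 \<le> inner ((x - T x) - (y - T y)) (x - y)"
proof -
  have "norm (T x - T y) \<le> norm (x - y)"
    using lipschitz_onD[OF assms, of x y] by (simp add: dist_norm)
  then have "norm (T x - T y) * norm (x - y) \<le> norm (x - y) * norm (x - y)"
    by (intro mult_right_mono) auto
  moreover have "inner (T x - T y) (x - y) \<le> norm (T x - T y) * norm (x - y)"
    by (rule norm_cauchy_schwarz)
  moreover have "norm (x - y) * norm (x - y) = inner (x - y) (x - y)"
    by (simp add: dot_square_norm power2_eq_square)
  moreover have "(x - T x) - (y - T y) = (x - y) - (T x - T y)"
    by simp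
  ultimately show ?thesis
    by (simp only: inner_diff_left)
qed

text \<open>Rearranged as \<open>x = \<alpha> / (1 + \<alpha>) T x\<close>, the equation asks for a fixed point of a strict
  contraction.\<close>

lemma displacement_resolvent_exists:
  fixes T :: "'h::{real_inner, complete_space} \<Rightarrow> 'h"
  assumes T: "1-lipschitz_on UNIV T" and "0 \<le> \<alpha>"
  shows "\<exists>x. x = - \<alpha> *\<^sub>R (x - T x)"
proof -
  define c where "c = \<alpha> / (1 + \<alpha>)"
  have c: "0 \<le> c" "c < 1" and c_eq: "(1 + \<alpha>) * c = \<alpha>"
    using \<open>0 \<le> \<alpha>\<close> by (auto simp: c_def)
  have "dist (c *\<^sub>R T x) (c *\<^sub>R T y) \<le> c * dist x y" for x y
    using lipschitz_onD[OF T, of x y] c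
    by (simp add: dist_norm mult_left_mono flip: scaleR_diff_right)
  then obtain x where x: "c *\<^sub>R T x = x"
    using banach_fix_type[OF c, of "\<lambda>x. c *\<^sub>R T x"] by auto
  have "(1 + \<alpha>) *\<^sub>R x = \<alpha> *\<^sub>R T x"
    using c_eq by (metis x scaleR_scaleR)
  then have "x + \<alpha> *\<^sub>R x = \<alpha> *\<^sub>R T x"
    by (simp add: scaleR_add_left)
  then have "x = \<alpha> *\<^sub>R T x - \<alpha> *\<^sub>R x"
    by (simp only: eq_diff_eq)
  also have "\<dots> = - \<alpha> *\<^sub>R (x - T x)"
    by (simp add: scaleR_diff_right)
  finally have "x = - \<alpha> *\<^sub>R (x - T x)" .
  then show ?thesis ..
qed

text \<open>The displacements of the resolvents decrease in norm, and the loss in squared norm controls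
  their distance; this is what makes them a Cauchy sequence.\<close>

lemma resolvent_displacement_dist:
  fixes T :: "'h::real_inner \<Rightarrow> 'h"
  assumes T: "1-lipschitz_on UNIV T"
    and x: "x = - \<alpha> *\<^sub>R (x - T x)" and y: "y = - \<beta> *\<^sub>R (y - T y)"
    and "0 \<le> \<alpha>" "\<alpha> < \<beta>"
  shows "(norm ((x - T x) - (y - T y)))\<^sup>2 \<le> (norm (x - T x))\<^sup>2 - (norm (y - T y))\<^sup>2"
proof -
  define p q where "p = x - T x" and "q = y - T y"
  have "x = - \<alpha> *\<^sub>R p" "y = - \<beta> *\<^sub>R q"
    using x y unfolding p_def q_def .
  then have "x - y = - \<alpha> *\<^sub>R p - (- \<beta> *\<^sub>R q)"
    by (rule arg_cong2[where f = minus])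
  also have "\<dots> = - \<alpha> *\<^sub>R (p - q) + (\<beta> - \<alpha>) *\<^sub>R q"
    by (simp add: scaleR_diff_left scaleR_diff_right)
  finally have "x - y = - \<alpha> *\<^sub>R (p - q) + (\<beta> - \<alpha>) *\<^sub>R q" .
  then have "0 \<le> inner (p - q) (- \<alpha> *\<^sub>R (p - q) + (\<beta> - \<alpha>) *\<^sub>R q)"
    using displacement_monotone[OF T, of x y] by (simp add: p_def q_def)
  then have "\<alpha> * (norm (p - q))\<^sup>2 \<le> (\<beta> - \<alpha>) * inner (p - q) q"
    by (simp only: inner_add_right inner_scaleR_right power2_norm_eq_inner)
  moreover have "0 \<le> \<alpha> * (norm (p - q))\<^sup>2"
    using \<open>0 \<le> \<alpha>\<close> by simp
  ultimately have "0 \<le> (\<beta> - \<alpha>) * inner (p - q) q"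
    by linarith
  then have "0 \<le> inner (p - q) q"
    using \<open>\<alpha> < \<beta>\<close> by (simp add: zero_le_mult_iff)
  then have "(norm (p - q))\<^sup>2 \<le> (norm p)\<^sup>2 - (norm q)\<^sup>2"
    by (simp add: power2_norm_eq_inner algebra_simps inner_commute)
  then show ?thesis
    by (simp add: p_def q_def)
qed

lemma Cauchy_if_dist_le_norm_decrease:
  fixes p :: "nat \<Rightarrow> 'a::real_normed_vector"
  assumes p: "\<And>m n. m < n \<Longrightarrow> (norm (p m - p n))\<^sup>2 \<le> (norm (p m))\<^sup>2 - (norm (p n))\<^sup>2"
  shows "Cauchy p"
proof -
  have "(norm (p n))\<^sup>2 \<le> (norm (p m))\<^sup>2" if "m \<le> n" for m n
  proof (cases "m = n")
    case False
    with that have "(norm (p m - p n))\<^sup>2 \<le> (norm (p m))\<^sup>2 - (norm (p n))\<^sup>2"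
      by (intro p) simp
    then show ?thesis
      using zero_le_power2[of "norm (p m - p n)"] by linarith
  qed simp
  then have "decseq (\<lambda>n. (norm (p n))\<^sup>2)"
    by (auto simp: decseq_def)
  then obtain L where "(\<lambda>n. (norm (p n))\<^sup>2) \<longlonglongrightarrow> L"
    by (rule decseq_convergent[where B = 0]) auto
  then have C: "Cauchy (\<lambda>n. (norm (p n))\<^sup>2)"
    by (rule LIMSEQ_imp_Cauchy)
  show ?thesis
    unfolding Cauchy_altdef
  proof (intro allI impI)
    fix e :: real assume "0 < e"
    then obtain M where M: "\<And>m n. M \<le> m \<Longrightarrow> m < n \<Longrightarrow> dist ((norm (p m))\<^sup>2) ((norm (p n))\<^sup>2) < e\<^sup>2"
      using C unfolding Cauchy_altdef by (meson zero_less_power)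
    have "dist (p m) (p n) < e" if "M \<le> m" "m < n" for m n
    proof -
      have "(norm (p m - p n))\<^sup>2 < e\<^sup>2"
        using p[OF that(2)] M[OF that] by (simp add: dist_real_def)
      then show ?thesis
        using \<open>0 < e\<close> by (simp add: dist_norm power2_less_imp_less)
    qed
    then show "\<exists>M. \<forall>m\<ge>M. \<forall>n>m. dist (p m) (p n) < e"
      by blast
  qed
qed

lemma displacement_variational_vector_exists:
  fixes T :: "'h::{real_inner, complete_space} \<Rightarrow> 'h"
  assumes T: "1-lipschitz_on UNIV T"
  shows "\<exists>v \<in> closure (range (\<lambda>x. x - T x)). \<forall>z. (norm v)\<^sup>2 \<le> inner (z - T z) v"
proof -
  \<comment> \<open>Any parameters increasing to infinity would do.\<close>
  have "\<forall>n. \<exists>x. x = - real (Suc n) *\<^sub>R (x - T x)"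
    using displacement_resolvent_exists[OF T] by (metis of_nat_0_le_iff)
  from choice[OF this]
  obtain x where x: "\<And>n. x n = - real (Suc n) *\<^sub>R (x n - T (x n))"
    by blast
  define p where "p n = x n - T (x n)" for n
  have "(norm (p m - p n))\<^sup>2 \<le> (norm (p m))\<^sup>2 - (norm (p n))\<^sup>2" if "m < n" for m n
    unfolding p_def using that by (intro resolvent_displacement_dist[OF T x x]) auto
  then have "Cauchy p"
    by (rule Cauchy_if_dist_le_norm_decrease)
  then obtain v where v: "p \<longlonglongrightarrow> v"
    using Cauchy_convergent convergent_def by blast
  have "(norm v)\<^sup>2 \<le> inner (z - T z) v" for z
  proof -
    \<comment> \<open>Monotonicity at \<open>z\<close> and \<open>x n = - (n + 1) p n\<close>, scaled so that the possibly unbounded \<open>x n\<close> drops out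
      before the limit is taken.\<close>
    have "0 \<le> inner ((z - T z) - p n) (inverse (real (Suc n)) *\<^sub>R z + p n)" for n
    proof -
      have "z - x n = real (Suc n) *\<^sub>R (inverse (real (Suc n)) *\<^sub>R z + p n)"
        by (subst x) (simp add: p_def scaleR_add_right del: of_nat_Suc)
      then show ?thesis
        using displacement_monotone[OF T, of z "x n"]
        by (simp add: zero_le_mult_iff p_def del: of_nat_Suc)
    qed
    moreover have "(\<lambda>n. inner ((z - T z) - p n) (inverse (real (Suc n)) *\<^sub>R z + p n))
        \<longlonglongrightarrow> inner ((z - T z) - v) (0 *\<^sub>R z + v)"
      by (intro tendsto_intros v LIMSEQ_inverse_real_of_nat)
    ultimately have "0 \<le> inner ((z - T z) - v) (0 *\<^sub>R z + v)"
      by (intro LIMSEQ_le_const) auto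
    then show ?thesis
      by (simp add: inner_diff_left power2_norm_eq_inner)
  qed
  moreover have "v \<in> closure (range (\<lambda>x. x - T x))"
    using v unfolding closure_sequential by (auto simp: p_def intro!: exI[of _ p])
  ultimately show ?thesis
    by blast
qed

text \<open>A point of \<open>S\<close> satisfying the variational inequality is the only candidate for the nearest
  point to the origin: \<open>\<parallel>p\<parallel> \<le> \<parallel>v\<parallel>\<close> and \<open>\<parallel>v\<parallel>\<^sup>2 \<le> \<langle>p, v\<rangle>\<close> force \<open>\<parallel>p - v\<parallel>\<^sup>2 \<le> 0\<close>. So the definite
  description in \<^const>\<open>hilbert_projection\<close> denotes \<open>v\<close>.\<close>

lemma hilbert_projection_zero_eqI:
  fixes v :: "'a::real_inner"
  assumes "v \<in> S" and v: "\<And>y. y \<in> S \<Longrightarrow> (norm v)\<^sup>2 \<le> inner y v"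
  shows "hilbert_projection S 0 = v"
  unfolding hilbert_projection_def
proof (rule the_equality)
  have "norm v \<le> norm y" if "y \<in> S" for y
  proof (cases "v = 0")
    case False
    have "norm v * norm v \<le> norm y * norm v"
      using v[OF that] norm_cauchy_schwarz[of y v] by (simp add: power2_eq_square)
    with False show ?thesis
      by simp
  qed simp
  with \<open>v \<in> S\<close> show "v \<in> S \<and> (\<forall>y\<in>S. dist 0 v \<le> dist 0 y)"
    by simp
next
  fix p assume p: "p \<in> S \<and> (\<forall>y\<in>S. dist 0 p \<le> dist 0 y)"
  then have "norm p \<le> norm v"
    using \<open>v \<in> S\<close> by simp
  then have "(norm p)\<^sup>2 \<le> (norm v)\<^sup>2"
    by (rule power_mono) simp
  moreover have "(norm v)\<^sup>2 \<le> inner p v"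
    using p v by blast
  moreover have "(norm (p - v))\<^sup>2 = (norm p)\<^sup>2 - 2 * inner p v + (norm v)\<^sup>2"
    by (simp add: power2_norm_eq_inner algebra_simps inner_commute)
  ultimately have "(norm (p - v))\<^sup>2 \<le> 0"
    by linarith
  then show "p = v"
    by simp
qed

lemma infimal_displacement_vector_inner_le:
  fixes T :: "'h::{real_inner, complete_space} \<Rightarrow> 'h"
  assumes T: "1-lipschitz_on UNIV T"
  shows "(norm (infimal_displacement_vector T))\<^sup>2 \<le> inner (z - T z) (infimal_displacement_vector T)"
proof -
  let ?R = "range (\<lambda>x. x - T x)"
  obtain v where v: "v \<in> closure ?R" "\<And>z. (norm v)\<^sup>2 \<le> inner (z - T z) v"
    using displacement_variational_vector_exists[OF T] by blast
  have "closed {y. (norm v)\<^sup>2 \<le> inner y v}"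
    by (intro closed_Collect_le continuous_intros)
  then have "closure ?R \<subseteq> {y. (norm v)\<^sup>2 \<le> inner y v}"
    using v(2) by (intro closure_minimal) auto
  then have "infimal_displacement_vector T = v"
    unfolding infimal_displacement_vector_def
    using v(1) by (intro hilbert_projection_zero_eqI) auto
  with v(2) show ?thesis
    by simp
qed

section \<open>Distance of the iterates to the comparison ray\<close>

text \<open>The exact step has \<open>\<delta> = \<epsilon> = 0\<close>. Both \<open>x\<close> and \<open>T x\<close> are compared with points of the ray
  \<open>w - s v\<close>, and the parameter advances by one full unit when \<open>T\<close> is applied. The condition
  \<open>\<delta> (\<parallel>v\<parallel> + \<epsilon>) \<le> \<epsilon>\<^sup>2\<close> is what lets the cross term of \<open>(A + \<epsilon> s + (\<epsilon> - \<delta>))\<^sup>2\<close> absorb the error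
  \<open>2 s \<delta> \<parallel>v\<parallel>\<close> for all \<open>s\<close> at once.\<close>

lemma distance_to_ray_step:
  fixes T :: "'h::real_inner \<Rightarrow> 'h"
  assumes T: "1-lipschitz_on UNIV T"
    and v: "(norm v)\<^sup>2 \<le> inner (x - T x) v"
    and w: "norm (w - T w - v) \<le> \<delta>"
    and \<delta>: "\<delta> \<le> \<epsilon>" "\<delta> * (norm v + \<epsilon>) \<le> \<epsilon>\<^sup>2"
    and nonneg: "0 \<le> s" "0 \<le> A"
    and x: "norm (x - w + s *\<^sub>R v) \<le> A + \<epsilon> * s"
  shows "norm (T x - w + (s + 1) *\<^sub>R v) \<le> A + \<epsilon> * (s + 1)"
proof -
  define e where "e = w - T w - v"
  define a b where "a = x - w + s *\<^sub>R v" and "b = T x - T w + s *\<^sub>R v"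
  have "0 \<le> \<delta>"
    using w norm_ge_zero order_trans by blast
  with \<delta> have "0 \<le> \<epsilon>"
    by linarith
  have "norm (b - s *\<^sub>R v) \<le> norm (a - s *\<^sub>R v)"
    using lipschitz_onD[OF T, of x w] by (simp add: a_def b_def dist_norm)
  then have "(norm (b - s *\<^sub>R v))\<^sup>2 \<le> (norm (a - s *\<^sub>R v))\<^sup>2"
    by (rule power_mono) simp
  then have "(norm b)\<^sup>2 \<le> (norm a)\<^sup>2 + 2 * s * inner (b - a) v"
    by (simp add: power2_norm_eq_inner algebra_simps inner_commute)
  also have "\<dots> \<le> (norm a)\<^sup>2 + 2 * s * (\<delta> * norm v)"
  proof -
    have "b - a = e + v - (x - T x)"
      by (simp add: a_def b_def e_def)
    then have "inner (b - a) v = inner e v + inner v v - inner (x - T x) v"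
      by (simp only: inner_add_left inner_diff_left)
    also have "\<dots> \<le> inner e v"
      using v by (simp add: power2_norm_eq_inner)
    also have "\<dots> \<le> norm e * norm v"
      by (rule norm_cauchy_schwarz)
    also have "\<dots> \<le> \<delta> * norm v"
      using w by (simp add: e_def mult_right_mono)
    finally show ?thesis
      using \<open>0 \<le> s\<close> by (simp add: mult_left_mono)
  qed
  also have "\<dots> \<le> (A + \<epsilon> * s)\<^sup>2 + 2 * s * (\<epsilon> * (\<epsilon> - \<delta>))"
  proof -
    have "(norm a)\<^sup>2 \<le> (A + \<epsilon> * s)\<^sup>2"
      using x by (auto simp: a_def intro: power_mono)
    moreover have "\<delta> * norm v \<le> \<epsilon> * (\<epsilon> - \<delta>)"
      using \<delta>(2) by (simp add: algebra_simps power2_eq_square)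
    ultimately show ?thesis
      using \<open>0 \<le> s\<close> by (intro add_mono mult_left_mono) auto
  qed
  also have "\<dots> \<le> (A + \<epsilon> * s + (\<epsilon> - \<delta>))\<^sup>2"
  proof -
    have "(A + \<epsilon> * s + (\<epsilon> - \<delta>))\<^sup>2
        = (A + \<epsilon> * s)\<^sup>2 + 2 * s * (\<epsilon> * (\<epsilon> - \<delta>)) + (2 * (A * (\<epsilon> - \<delta>)) + (\<epsilon> - \<delta>)\<^sup>2)"
      by (simp add: algebra_simps power2_eq_square)
    moreover have "0 \<le> A * (\<epsilon> - \<delta>)"
      using nonneg \<delta>(1) by simp
    ultimately show ?thesis
      by simp
  qed
  finally have "norm b \<le> A + \<epsilon> * s + (\<epsilon> - \<delta>)"
    by (rule power2_le_imp_le) (use nonneg \<delta>(1) \<open>0 \<le> \<epsilon>\<close> in auto)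
  moreover have "T x - w + (s + 1) *\<^sub>R v = b - e"
    by (simp add: b_def e_def algebra_simps)
  ultimately show ?thesis
    using norm_triangle_ineq4[of b e] w by (simp add: e_def algebra_simps)
qed

text \<open>The weight \<open>\<lambda>\<close> averages the ray parameters \<open>s\<close> and \<open>s + 1\<close> to \<open>s + (1 - \<lambda>)\<close>, which is why
  the partial sums of \<open>1 - \<lambda>\<^sub>i\<close> are the natural time scale.\<close>

lemma KM_distance_to_ray:
  fixes T :: "'h::real_inner \<Rightarrow> 'h" and lam :: "nat \<Rightarrow> real" and x :: "nat \<Rightarrow> 'h"
  assumes T: "1-lipschitz_on UNIV T"
    and v: "\<And>z. (norm v)\<^sup>2 \<le> inner (z - T z) v"
    and lam: "\<And>k. k \<ge> 1 \<Longrightarrow> 0 \<le> lam k \<and> lam k \<le> 1"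
    and KM: "\<And>k. x (k + 1) = lam (k + 1) *\<^sub>R x k + (1 - lam (k + 1)) *\<^sub>R T (x k)"
    and w: "norm (w - T w - v) \<le> \<delta>"
    and \<delta>: "\<delta> \<le> \<epsilon>" "\<delta> * (norm v + \<epsilon>) \<le> \<epsilon>\<^sup>2"
  shows "norm (x k - w + (\<Sum>i=1..k. 1 - lam i) *\<^sub>R v) \<le> norm (x 0 - w) + \<epsilon> * (\<Sum>i=1..k. 1 - lam i)"
proof (induction k)
  case (Suc k)
  define s l where "s = (\<Sum>i=1..k. 1 - lam i)" and "l = lam (k + 1)"
  let ?A = "norm (x 0 - w)"
  have "0 \<le> s"
    unfolding s_def using lam by (intro sum_nonneg) auto
  have l: "0 \<le> l" "l \<le> 1"
    using lam by (auto simp: l_def)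
  have IH: "norm (x k - w + s *\<^sub>R v) \<le> ?A + \<epsilon> * s"
    using Suc.IH by (simp add: s_def)
  have step: "norm (T (x k) - w + (s + 1) *\<^sub>R v) \<le> ?A + \<epsilon> * (s + 1)"
    using distance_to_ray_step[OF T v w \<delta> \<open>0 \<le> s\<close> norm_ge_zero IH] .
  have "x (Suc k) - w + (s + (1 - l)) *\<^sub>R v
      = l *\<^sub>R (x k - w + s *\<^sub>R v) + (1 - l) *\<^sub>R (T (x k) - w + (s + 1) *\<^sub>R v)"
    using KM[of k] by (simp add: l_def algebra_simps)
  also have "norm \<dots> \<le> l * norm (x k - w + s *\<^sub>R v) + (1 - l) * norm (T (x k) - w + (s + 1) *\<^sub>R v)"
    using l by (intro order_trans[OF norm_triangle_ineq]) simp
  also have "\<dots> \<le> l * (?A + \<epsilon> * s) + (1 - l) * (?A + \<epsilon> * (s + 1))"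
    using l IH step by (intro add_mono mult_left_mono) auto
  also have "\<dots> = ?A + \<epsilon> * (s + (1 - l))"
    by (simp add: algebra_simps)
  finally show ?case
    by (simp add: s_def l_def)
qed simp

lemma KM_normalized_rate:
  fixes T :: "'h::real_inner \<Rightarrow> 'h" and lam :: "nat \<Rightarrow> real" and x :: "nat \<Rightarrow> 'h"
  assumes T: "1-lipschitz_on UNIV T"
    and v: "\<And>z. (norm v)\<^sup>2 \<le> inner (z - T z) v"
    and lam: "\<And>k. k \<ge> 1 \<Longrightarrow> 0 \<le> lam k \<and> lam k < 1"
    and KM: "\<And>k. x (k + 1) = lam (k + 1) *\<^sub>R x k + (1 - lam (k + 1)) *\<^sub>R T (x k)"
    and w: "norm (w - T w - v) \<le> \<delta>"
    and \<delta>: "\<delta> \<le> \<epsilon>" "\<delta> * (norm v + \<epsilon>) \<le> \<epsilon>\<^sup>2"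
    and "k \<ge> 1"
  shows "norm ((x k - x 0) /\<^sub>R (\<Sum>i=1..k. 1 - lam i) + v)
    \<le> 2 / (\<Sum>i=1..k. 1 - lam i) * norm (x 0 - w) + \<epsilon>"
proof -
  define s where "s = (\<Sum>i=1..k. 1 - lam i)"
  have "0 < s"
    unfolding s_def
  proof (rule sum_pos)
    show "0 < 1 - lam i" if "i \<in> {1..k}" for i
      using lam[of i] that by simp
  qed (use \<open>k \<ge> 1\<close> in auto)
  have "norm (x k - w + s *\<^sub>R v) \<le> norm (x 0 - w) + \<epsilon> * s"
    unfolding s_def
  proof (rule KM_distance_to_ray[where T = T and x = x and lam = lam, OF T v _ KM w \<delta>])
    show "0 \<le> lam i \<and> lam i \<le> 1" if "1 \<le> i" for i
      using lam[OF that] by simp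
  qed
  moreover have "norm (x k - x 0 + s *\<^sub>R v) \<le> norm (x k - w + s *\<^sub>R v) + norm (x 0 - w)"
    using norm_triangle_ineq4[of "x k - w + s *\<^sub>R v" "x 0 - w"] by (simp add: algebra_simps)
  ultimately have *: "norm (x k - x 0 + s *\<^sub>R v) \<le> 2 * norm (x 0 - w) + \<epsilon> * s"
    by linarith
  have "(x k - x 0) /\<^sub>R s + v = (x k - x 0 + s *\<^sub>R v) /\<^sub>R s"
    using \<open>0 < s\<close> by (simp add: scaleR_add_right)
  then have "norm ((x k - x 0) /\<^sub>R s + v) = norm (x k - x 0 + s *\<^sub>R v) / s"
    using \<open>0 < s\<close> by (simp add: divide_inverse mult.commute)
  also have "\<dots> \<le> (2 * norm (x 0 - w) + \<epsilon> * s) / s"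
    using * \<open>0 < s\<close> by (intro divide_right_mono) auto
  also have "\<dots> = 2 / s * norm (x 0 - w) + \<epsilon>"
    using \<open>0 < s\<close> by (simp add: field_simps)
  finally show ?thesis
    by (simp add: s_def)
qed

section \<open>The rate from the stated tolerance\<close>

text \<open>The threshold \<open>\<epsilon>\<^sup>2 / (2 n + 1)\<close> suffices as long as \<open>\<epsilon> \<le> n + 1\<close>; for larger \<open>\<epsilon>\<close> the bound by
  \<open>1\<close> takes over.\<close>

lemma displacement_tolerance_sufficient:
  fixes n \<epsilon> \<delta> :: real
  assumes "0 \<le> n" "0 < \<epsilon>" "0 \<le> \<delta>" "\<delta> \<le> \<epsilon>\<^sup>2 / (2 * n + 1)" "\<delta> \<le> 1"
  shows "\<delta> * (n + \<epsilon>) \<le> \<epsilon>\<^sup>2"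
proof (cases "\<epsilon> \<le> n + 1")
  case True
  then have "\<delta> * (n + \<epsilon>) \<le> \<delta> * (2 * n + 1)"
    using assms by (intro mult_left_mono) auto
  also have "\<dots> \<le> \<epsilon>\<^sup>2"
    using assms by (simp add: field_simps)
  finally show ?thesis .
next
  case False
  have "\<delta> * (n + \<epsilon>) \<le> n + \<epsilon>"
    using assms by (simp add: mult_left_le_one_le)
  also have "\<dots> \<le> (n + 1) * \<epsilon>"
  proof -
    have "n * 1 \<le> n * \<epsilon>"
      using assms False by (intro mult_left_mono) auto
    then show ?thesis
      by (simp add: algebra_simps)
  qed
  also have "\<dots> \<le> \<epsilon>\<^sup>2"
    using False assms by (simp add: power2_eq_square mult_right_mono)
  finally show ?thesis .
qed

theorem theorem3:
  fixes T :: "'h::{real_inner, complete_space} \<Rightarrow> 'h"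
    and v :: 'h
    and lam :: "nat \<Rightarrow> real"
    and x :: "nat \<Rightarrow> 'h"
  assumes nonexpansive: "1-lipschitz_on UNIV T"
    and v: "v = infimal_displacement_vector T"
    and lambda: "\<And>k. k \<ge> 1 \<Longrightarrow> 0 \<le> lam k \<and> lam k < 1"
    and KM: "\<And>k. x (k + 1) = lam (k + 1) *\<^sub>R x k + (1 - lam (k + 1)) *\<^sub>R T (x k)"
  shows "(\<forall>\<epsilon>>0. \<forall>x\<^sub>\<epsilon>.
            norm (x\<^sub>\<epsilon> - T x\<^sub>\<epsilon> - v) \<le> min (\<epsilon>\<^sup>2 / (2 * norm v + 1)) (min 1 \<epsilon>) \<longrightarrow>
            (\<forall>k\<ge>1. (norm ((x k - x 0) /\<^sub>R (\<Sum>i=1..k. 1 - lam i) + v))\<^sup>2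
                    \<le> (2 / (\<Sum>i=1..k. 1 - lam i) * norm (x 0 - x\<^sub>\<epsilon>) + \<epsilon>)\<^sup>2))
       \<and> (v \<in> range (\<lambda>y. y - T y) \<longrightarrow>
            (\<exists>x_star. x_star - T x_star = v \<and>
              (\<forall>k\<ge>1. (norm ((x k - x 0) /\<^sub>R (\<Sum>i=1..k. 1 - lam i) + v))\<^sup>2
                      \<le> 4 / (\<Sum>i=1..k. 1 - lam i)\<^sup>2 * (norm (x 0 - x_star))\<^sup>2)))"
proof (intro conjI allI impI)
  have v_ineq: "(norm v)\<^sup>2 \<le> inner (z - T z) v" for z
    unfolding v by (rule infimal_displacement_vector_inner_le[OF nonexpansive])
  note rate = KM_normalized_rate[where T = T and v = v and lam = lam and x = x,
      OF nonexpansive v_ineq lambda KM]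
  {
    fix \<epsilon> :: real and x\<^sub>\<epsilon> :: 'h and k :: nat
    assume "0 < \<epsilon>" "1 \<le> k"
      and w: "norm (x\<^sub>\<epsilon> - T x\<^sub>\<epsilon> - v) \<le> min (\<epsilon>\<^sup>2 / (2 * norm v + 1)) (min 1 \<epsilon>)"
    then have "norm (x\<^sub>\<epsilon> - T x\<^sub>\<epsilon> - v) * (norm v + \<epsilon>) \<le> \<epsilon>\<^sup>2"
      by (intro displacement_tolerance_sufficient) auto
    then show "(norm ((x k - x 0) /\<^sub>R (\<Sum>i=1..k. 1 - lam i) + v))\<^sup>2
        \<le> (2 / (\<Sum>i=1..k. 1 - lam i) * norm (x 0 - x\<^sub>\<epsilon>) + \<epsilon>)\<^sup>2"
      using w \<open>1 \<le> k\<close> by (intro power_mono rate[where \<delta> = "norm (x\<^sub>\<epsilon> - T x\<^sub>\<epsilon> - v)"]) auto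
  next
    assume "v \<in> range (\<lambda>y. y - T y)"
    then obtain w where w: "w - T w = v"
      by auto
    have "(norm ((x k - x 0) /\<^sub>R (\<Sum>i=1..k. 1 - lam i) + v))\<^sup>2
        \<le> 4 / (\<Sum>i=1..k. 1 - lam i)\<^sup>2 * (norm (x 0 - w))\<^sup>2" if "1 \<le> k" for k
    proof -
      have "norm ((x k - x 0) /\<^sub>R (\<Sum>i=1..k. 1 - lam i) + v)
          \<le> 2 / (\<Sum>i=1..k. 1 - lam i) * norm (x 0 - w) + 0"
        using w that by (intro rate[where \<delta> = 0]) auto
      then have "(norm ((x k - x 0) /\<^sub>R (\<Sum>i=1..k. 1 - lam i) + v))\<^sup>2
          \<le> (2 / (\<Sum>i=1..k. 1 - lam i) * norm (x 0 - w) + 0)\<^sup>2"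
        by (rule power_mono) simp
      then show ?thesis
        by (simp add: power_mult_distrib power_divide)
    qed
    with w show "\<exists>x_star. x_star - T x_star = v \<and>
        (\<forall>k\<ge>1. (norm ((x k - x 0) /\<^sub>R (\<Sum>i=1..k. 1 - lam i) + v))\<^sup>2
          \<le> 4 / (\<Sum>i=1..k. 1 - lam i)\<^sup>2 * (norm (x 0 - x_star))\<^sup>2)"
      by blast
  }
qed

end
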